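(* Fix training data $\mathcal{T}_n$, a regressor $x_{n+1}$, a conformity score given by the absolute in-sample prediction error $\mathcal{C}^{\mathrm{in}}_n$ that is unimodal (at $\mathcal{T}_n$, $x_{n+1}$), $\alpha\in(0,1)$ and $\delta\in\mathbb{R}$. Then the Shortcut Algorithm described in the context, applied with boundary parameter $K\in\mathbb{Z}$ and tolerance level $\epsilon\in(0,2^K]$, creates a (possibly unbounded) interval $PI$ such that the following holds. (1) $PS^{\mathrm{sc}}_{n,\alpha}(\delta)\subseteq PI$. (2) If $\emptyset\ne PS^{\mathrm{sc}}_{n,\alpha}(\delta)\subseteq[-2^K+\epsilon,\,2^K-\epsilon]$, then $\lambda(PI\setminus PS^{\mathrm{sc}}_{n,\alpha}(\delta))\le2\epsilon$, where $\lambda$ denotes Lebesgue measure. (3) With $\phi=\frac{\sqrt5+1}{2}$ the golden ratio, the prediction algorithm needs to be refitted no more than $$\Big\lfloor 10+\Big(K+1+\log_2\big(\tfrac1\epsilon\big)\Big)\Big(2+\frac{1}{\log_2(\phi)}\Big)\Big\rfloor\;\le\;13.45+3.45\,\log_2\Big(\frac{2^K}{\epsilon}\Big)$$ times.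
   Context: Setting. $\mathcal{Y}_n=\mathbb{R}$, $\mathcal{X}_n$ a Euclidean space, $\mathcal{Z}_n=\mathcal{Y}_n\times\mathcal{X}_n$, $\mathcal{T}_n=(t_1,\dots,t_n)$ with $t_i=(y_i,x_i)\in\mathcal{Z}_n$, $x_{n+1}\in\mathcal{X}_n$; $\mathcal{T}_n^{\setminus i}$ is $\mathcal{T}_n$ with $t_i$ removed. A prediction algorithm $\mathcal{A}=(\mathcal{A}_{n,m})_m$ consists of measurable functions $\mathcal{A}_{n,m}:\mathcal{X}_n\times\mathcal{Z}_n^m\to\mathcal{Y}_n$ invariant under permutations of the $m$ training points. The absolute in-sample prediction error is $\mathcal{C}_m((y,x),T)=\mathcal{C}_m^{\mathrm{in}}((y,x),T)=|y-\mathcal{A}_{n,m+1}(x,T\cup(y,x))|$ for $T\in\mathcal{Z}_n^m$, where $T\cup(y,x)$ is $T$ with $(y,x)$ appended. Write $g(y)=\mathcal{C}_n((y,x_{n+1}),\mathcal{T}_n)$. Unimodality (at $\mathcal{T}_n,x_{n+1}$): there is $m^*\in\mathbb{R}$ such that $g$ is strictly decreasing on $(-\infty,m^*]$ and strictly increasing on $[m^*,\infty)$. Shortcut set. $PS^{\mathrm{sc}}_{n,\alpha}(\delta)=\{y\in\mathbb{R}:g(y)\le b\}$ with $b=\hat G^{-1}(1-\alpha)+\delta$, where $\hat G(s)=\frac1n\sum_{i=1}^n\mathds{1}\{\mathcal{C}_{n-1}(t_i,\mathcal{T}_n^{\setminus i})\le s\}$ is the empirical cdf of the absolute fitted errors $|y_i-\mathcal{A}_{n,n}(x_i,\mathcal{T}_n)|$,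 and $\hat G^{-1}(\beta)=\inf\{x:\hat G(x)\ge\beta\}$. Refits. Computing $b$ requires one fit (of the predictor on $\mathcal{T}_n$); each evaluation of $g$ at a point $y$ requires one refit (on $\mathcal{T}_n\cup(y,x_{n+1})$). Procedure BiSection$(L,U)$ (for $g(U)>b\ge g(L)$; $L<U$ or $L>U$): set $l=L$, $u=U$; while $|l-u|>\epsilon$: let $m=\frac{l+u}2$; if $g(m)>b$ set $u=m$, else set $l=m$. Return $\{l,u\}$ (first $l$, then $u$). Procedure Minimizer$(L,U)$ (for $L<U$): let $\gamma=\frac{\sqrt5-1}2$, compute $c_L=g(L)$, $c_U=g(U)$, $s=L+(1-\gamma)(U-L)$, $t=L+\gamma(U-L)$, $c_s=g(s)$, $c_t=g(t)$. While $U-L>\epsilon$: if $c_s>c_t$, then set $L\leftarrow s$, $c_L\leftarrow c_s$, $s\leftarrow t$, $t\leftarrow L+\gamma(U-L)$, $c_s\leftarrow c_t$, $c_t\leftarrow g(t)$; else set $U\leftarrow t$, $c_U\leftarrow c_t$, $t\leftarrow s$, $s\leftarrow L+(1-\gamma)(U-L)$, $c_t\leftarrow c_s$, $c_s\leftarrow g(s)$. At the end return $\{m,M\}=\{L,U\}$ (first $m=L$, then $M=U$) if $c_L<c_U$, and $\{m,M\}=\{U,L\}$ (i.e. $m=U$, $M=L$) otherwise. Shortcut Algorithm. Compute $b$, $c_1=g(-2^K)$, $c_2=g(2^K)$. - If $\max(c_1,c_2)\le b$, return $(-\infty,\infty)$. - Else if $c_1\le b<c_2$: $\{l,u\}\leftarrow$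 BiSection$(-2^K,2^K)$; return $(-\infty,u]$. - Else if $c_2\le b<c_1$: $\{l,u\}\leftarrow$ BiSection$(2^K,-2^K)$; return $[u,\infty)$. - Else ($b<\min(c_1,c_2)$): $\{m,M\}\leftarrow$ Minimizer$(-2^K,2^K)$. If $m=-2^K$, return $(-\infty,-2^K+\epsilon)$. Else if $m=2^K$, return $(2^K-\epsilon,\infty)$. Else, evaluate $g(m)$: if $g(m)>b$, return $(\min(m,M),\max(m,M))$; otherwise $\{l_0,l_1\}\leftarrow$ BiSection$(m,-2^K)$, $\{u_0,u_1\}\leftarrow$ BiSection$(m,2^K)$, and return $[l_1,u_1]$. *)

theory Defs
  imports "HOL-Analysis.Analysis" "HOL-Library.While_Combinator" "HOL-Library.Monad_Syntax"
begin

section \<open>Prediction algorithms and the shortcut set\<close>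

text \<open>
  A data point is a pair \<open>(y, x)\<close> of a response and a regressor, and a training set of size \<open>m\<close>
  is a list of length \<open>m\<close>. One function on lists thus encodes the whole family of
  \<open>m\<close>-point predictors.
\<close>

type_synonym 'x predictor = "'x \<Rightarrow> (real \<times> 'x) list \<Rightarrow> real"

definition prediction_algorithm :: "'x::euclidean_space predictor \<Rightarrow> bool" where
  "prediction_algorithm A \<longleftrightarrow>
     (\<forall>m. (\<lambda>(x, t). A x (map t [0..<m]))
            \<in> borel_measurable (borel \<Otimes>\<^sub>M (\<Pi>\<^sub>M i\<in>{..<m}. borel))) \<and>
     (\<forall>x T T'. mset T = mset T' \<longrightarrow> A x T = A x T')"

definition in_sample_error :: "'x predictor \<Rightarrow> real \<times> 'x \<Rightarrow> (real \<times> 'x) list \<Rightarrow> real" where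
  "in_sample_error A = (\<lambda>(y, x) T. \<bar>y - A x (T @ [(y, x)])\<bar>)"

definition unimodal :: "(real \<Rightarrow> real) \<Rightarrow> bool" where
  "unimodal g \<longleftrightarrow> (\<exists>m. strict_antimono_on {..m} g \<and> strict_mono_on {m..} g)"

definition remove_nth :: "nat \<Rightarrow> 'a list \<Rightarrow> 'a list" where
  "remove_nth i T = take i T @ drop (Suc i) T"

definition error_cdf :: "'x predictor \<Rightarrow> (real \<times> 'x) list \<Rightarrow> real \<Rightarrow> real" where
  "error_cdf A T s =
     1 / real (length T) *
       (\<Sum>i<length T. of_bool (in_sample_error A (T ! i) (remove_nth i T) \<le> s))"

definition quantile :: "(real \<Rightarrow> real) \<Rightarrow> real \<Rightarrow> real" where
  "quantile G \<beta> = Inf {x. G x \<ge> \<beta>}"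

definition threshold :: "'x predictor \<Rightarrow> (real \<times> 'x) list \<Rightarrow> real \<Rightarrow> real \<Rightarrow> real" where
  "threshold A T \<alpha> \<delta> = quantile (error_cdf A T) (1 - \<alpha>) + \<delta>"

definition shortcut_set ::
  "'x predictor \<Rightarrow> (real \<times> 'x) list \<Rightarrow> 'x \<Rightarrow> real \<Rightarrow> real \<Rightarrow> real set" where
  "shortcut_set A T x \<alpha> \<delta> = {y. in_sample_error A (y, x) T \<le> threshold A T \<alpha> \<delta>}"


section \<open>Computations that count refits\<close>

text \<open>
  \<open>Some (v, k)\<close> is a computation that ends with value \<open>v\<close> after \<open>k\<close> fits of the predictor;
  \<open>None\<close> is a computation that does not terminate.
\<close>

type_synonym 'a run = "('a \<times> nat) option"

definition return :: "'a \<Rightarrow> 'a run" where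
  "return v = Some (v, 0)"

definition bind_run :: "'a run \<Rightarrow> ('a \<Rightarrow> 'b run) \<Rightarrow> 'b run" where
  "bind_run r f =
     (case r of None \<Rightarrow> None
      | Some (v, k) \<Rightarrow> map_option (\<lambda>(w, j). (w, k + j)) (f v))"

no_adhoc_overloading Monad_Syntax.bind \<rightleftharpoons> Option.bind
adhoc_overloading Monad_Syntax.bind \<rightleftharpoons> bind_run

definition one_fit :: "'a \<Rightarrow> 'a run" where
  "one_fit v = Some (v, 1)"

text \<open>
  The inner \<open>None\<close> (a diverging loop body) and the outer \<open>None\<close> (infinitely many
  iterations) are identified.
\<close>

definition run_while :: "('s \<Rightarrow> bool) \<Rightarrow> ('s \<Rightarrow> 's run) \<Rightarrow> 's \<Rightarrow> 's run" where
  "run_while c body s =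
     (case while_option (\<lambda>r. case r of None \<Rightarrow> False | Some (s, k) \<Rightarrow> c s)
             (\<lambda>r. bind_run r body) (return s) of
        None \<Rightarrow> None
      | Some r \<Rightarrow> r)"


section \<open>The shortcut algorithm\<close>

text \<open>
  The procedures access \<open>g\<close> only through an argument \<open>eval\<close>, which charges one
  fit for each evaluation, including repeated evaluations at the same point.
  The threshold is charged one fit in total: by permutation invariance all of its
  errors \<open>in_sample_error A (T ! i) (remove_nth i T)\<close> are residuals of the single
  predictor fitted on \<open>T\<close>.
\<close>

definition bisection ::
  "(real \<Rightarrow> real run) \<Rightarrow> real \<Rightarrow> real \<Rightarrow> real \<Rightarrow> real \<Rightarrow> (real \<times> real) run" where
  "bisection eval b \<epsilon> L U =
     run_while (\<lambda>(l, u). \<bar>l - u\<bar> > \<epsilon>)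
       (\<lambda>(l, u). do {
          let m = (l + u) / 2;
          c \<leftarrow> eval m;
          return (if c > b then (l, m) else (m, u))
        })
       (L, U)"

definition minimizer ::
  "(real \<Rightarrow> real run) \<Rightarrow> real \<Rightarrow> real \<Rightarrow> real \<Rightarrow> (real \<times> real) run" where
  "minimizer eval \<epsilon> L\<^sub>0 U\<^sub>0 = (let \<gamma> = (sqrt 5 - 1) / 2 in do {
     c\<^sub>L \<leftarrow> eval L\<^sub>0;
     c\<^sub>U \<leftarrow> eval U\<^sub>0;
     let s = L\<^sub>0 + (1 - \<gamma>) * (U\<^sub>0 - L\<^sub>0);
     let t = L\<^sub>0 + \<gamma> * (U\<^sub>0 - L\<^sub>0);
     c\<^sub>s \<leftarrow> eval s;
     c\<^sub>t \<leftarrow> eval t;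
     (L, U, s, t, c\<^sub>L, c\<^sub>U, c\<^sub>s, c\<^sub>t) \<leftarrow>
       run_while (\<lambda>(L, U, _). U - L > \<epsilon>)
         (\<lambda>(L, U, s, t, c\<^sub>L, c\<^sub>U, c\<^sub>s, c\<^sub>t).
            if c\<^sub>s > c\<^sub>t then do {
              let t' = s + \<gamma> * (U - s);
              c \<leftarrow> eval t';
              return (s, U, t, t', c\<^sub>s, c\<^sub>U, c\<^sub>t, c)
            } else do {
              let s' = L + (1 - \<gamma>) * (t - L);
              c \<leftarrow> eval s';
              return (L, t, s', s, c\<^sub>L, c\<^sub>t, c, c\<^sub>s)
            })
         (L\<^sub>0, U\<^sub>0, s, t, c\<^sub>L, c\<^sub>U, c\<^sub>s, c\<^sub>t);
     return (if c\<^sub>L < c\<^sub>U then (L, U) else (U, L))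
   })"

definition shortcut_algorithm ::
  "'x predictor \<Rightarrow> (real \<times> 'x) list \<Rightarrow> 'x \<Rightarrow> real \<Rightarrow> real \<Rightarrow> int \<Rightarrow> real \<Rightarrow> real set run" where
  "shortcut_algorithm A T x \<alpha> \<delta> K \<epsilon> =
    (let B = 2 powi K;
         eval = (\<lambda>y. one_fit (in_sample_error A (y, x) T))
     in do {
       b \<leftarrow> one_fit (threshold A T \<alpha> \<delta>);
       c\<^sub>1 \<leftarrow> eval (- B);
       c\<^sub>2 \<leftarrow> eval B;
       if max c\<^sub>1 c\<^sub>2 \<le> b then return UNIV
       else if c\<^sub>1 \<le> b \<and> b < c\<^sub>2 then do {
         (l, u) \<leftarrow> bisection eval b \<epsilon> (- B) B;
         return {..u}
       }
       else if c\<^sub>2 \<le> b \<and> b < c\<^sub>1 then do {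
         (l, u) \<leftarrow> bisection eval b \<epsilon> B (- B);
         return {u..}
       }
       else do {
         (m, M) \<leftarrow> minimizer eval \<epsilon> (- B) B;
         if m = - B then return {..<- B + \<epsilon>}
         else if m = B then return {B - \<epsilon><..}
         else do {
           c \<leftarrow> eval m;
           if c > b then return {min m M<..<max m M}
           else do {
             (l\<^sub>0, l\<^sub>1) \<leftarrow> bisection eval b \<epsilon> m (- B);
             (u\<^sub>0, u\<^sub>1) \<leftarrow> bisection eval b \<epsilon> m B;
             return {l\<^sub>1..u\<^sub>1}
           }
         }
       }
     })"

end

theory Submission
  imports Defs
begin

text \<open>
  Write \<open>g y\<close> for the conformity score at \<open>y\<close>, \<open>b\<close> for the threshold, \<open>B = 2 powi K\<close> and
  \<open>S = {y. g y \<le> b}\<close>. A unimodal function satisfies the strict inequality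
  \<open>g y < max (g x) (g z)\<close> for \<open>x < y < z\<close> (\<open>unimodal_between\<close>), so \<open>S\<close> is an interval, and a point
  \<open>u\<close> with \<open>g u > b\<close> bounds \<open>S\<close> on the side that faces away from a point of \<open>S\<close>.

  Coverage and accuracy. Bisection keeps \<open>g l \<le> b < g u\<close> and halves the bracket
  (\<open>bisection_run\<close>), so it ends with an outer bound \<open>u\<close> of \<open>S\<close> and a point \<open>l\<close> of \<open>S\<close> at distance
  at most \<open>\<epsilon>\<close>. When both \<open>B\<close> and \<open>- B\<close> lie outside \<open>S\<close>, golden section search shrinks \<open>[L, U]\<close>
  while an endpoint that has moved stays on its own side of the mode (\<open>minimizer_run\<close>). If the
  better endpoint is \<open>- B\<close>, then \<open>S\<close> lies to the left of \<open>U\<close>, and symmetrically for \<open>B\<close>; if it is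
  interior with value above \<open>b\<close>, then \<open>S\<close> lies in \<open>]L, U[\<close>; if its value is at most \<open>b\<close>, two bisections
  bracket the two ends of \<open>S\<close>, with an error of at most \<open>\<epsilon>\<close> each. An unbounded output occurs only
  if \<open>S\<close> is empty or not contained in \<open>[- B + \<epsilon>, B - \<epsilon>]\<close>.

  Refits. Put \<open>X = log 2 (2 * B / \<epsilon>) \<ge> 1\<close>. A bisection of a bracket of width at most \<open>2 * B\<close> takes
  fewer than \<open>1 + X\<close> steps, and fewer than \<open>X\<close> steps if the width is at most \<open>B\<close>, which holds for
  one of the two final brackets. Golden section search takes \<open>4\<close> initial evaluations and fewer
  than \<open>1 + X / log 2 \<phi>\<close> steps. With the threshold, the two boundary values and \<open>g m\<close> the
  total is less than \<open>8 + (1 + X / log 2 \<phi>) + (1 + 2 * X)\<close>. The numerical bound is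
  \<open>1 / log 2 \<phi> \<le> 1.45\<close>, that is, \<open>2 ^ 20 \<le> \<phi> ^ 29\<close> (\<open>log2_golden_ratio\<close>).
\<close>

section \<open>Loops in the counting monad\<close>

lemma bind_run_simps [simp]:
  "bind_run (one_fit v) f = map_option (\<lambda>(w, j). (w, Suc j)) (f v)"
  "bind_run (return v) f = f v"
  "bind_run (Some (v, k)) f = map_option (\<lambda>(w, j). (w, k + j)) (f v)"
  by (auto simp: bind_run_def one_fit_def return_def option.map_id prod.case_eq_if
      intro!: option.map_ident_strong)

text \<open>
  Total correctness of a loop whose body costs one fit. As the loop starts at cost \<open>0\<close>, the cost
  is also the number of completed iterations, and the invariant \<open>P\<close> may refer to it.
\<close>

lemma run_while_induct:
  fixes P :: "nat \<Rightarrow> 's \<Rightarrow> bool"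
  assumes init: "P 0 s\<^sub>0"
    and step: "\<And>n s. P n s \<Longrightarrow> c s \<Longrightarrow> \<exists>s'. body s = Some (s', 1) \<and> P (Suc n) s'"
    and bound: "\<And>n s. P n s \<Longrightarrow> c s \<Longrightarrow> n < N"
  shows "\<exists>s n. run_while c body s\<^sub>0 = Some (s, n) \<and> P n s \<and> \<not> c s"
proof -
  let ?c = "\<lambda>r. case r of None \<Rightarrow> False | Some (s, k :: nat) \<Rightarrow> c s"
  let ?b = "\<lambda>r. bind_run r body"
  let ?Q = "\<lambda>r. case r of None \<Rightarrow> False | Some (s, k) \<Rightarrow> P k s"
  let ?f = "\<lambda>r. case r of None \<Rightarrow> 0 | Some (s :: 's, k) \<Rightarrow> N - k"
  have Q: "?Q (?b r) \<and> ?f (?b r) < ?f r" if Qr: "?Q r" "?c r" for r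
  proof -
    obtain s k where r: "r = Some (s, k)" "P k s" "c s"
      using Qr by (cases r) auto
    obtain s' where "body s = Some (s', 1)" "P (Suc k) s'" using step r by blast
    then show ?thesis using r bound[of k s] by auto
  qed
  have Q0: "?Q (return s\<^sub>0)" using init by (simp add: return_def)
  obtain r where r: "while_option ?c ?b (return s\<^sub>0) = Some r"
    using measure_while_option_Some[of ?Q ?c ?b ?f, OF Q Q0] by blast
  have "?Q r" using while_option_rule[of ?Q ?c ?b, OF _ r Q0] Q by blast
  moreover have "\<not> ?c r" using while_option_stop[OF r] .
  ultimately show ?thesis
    unfolding run_while_def r by (auto split: option.splits)
qed

section \<open>Unimodal functions\<close>

lemma unimodal_between:
  assumes "unimodal g" "x < y" "y < z"
  shows "g y < max (g x) (g z)"
proof -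
  obtain m where m: "strict_antimono_on {..m} g" "strict_mono_on {m..} g"
    using assms(1) by (auto simp: unimodal_def)
  show ?thesis
  proof (cases "y \<le> m")
    case True
    then have "g y < g x" using m(1) assms by (auto simp: monotone_on_def)
    then show ?thesis by simp
  next
    case False
    then have "g y < g z" using m(2) assms by (auto simp: monotone_on_def)
    then show ?thesis by simp
  qed
qed

lemma unimodal_sublevel_interval:
  assumes "unimodal g"
  shows "is_interval {y. g y \<le> b}"
  unfolding is_interval_1
proof safe
  fix x z y assume "g x \<le> b" "g z \<le> b" "x \<le> y" "y \<le> z"
  then show "g y \<le> b"
    using unimodal_between[OF assms, of x y z] by (cases "x = y"; cases "y = z") auto
qed

section \<open>The two search procedures\<close>

text \<open>
  The signed identity for \<open>u - l\<close> covers both orientations of the bracket and shows that \<open>u\<close> stays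
  on the same side of \<open>l\<close>. The last conjunct records that the loop condition held before the last
  iteration; it bounds the number \<open>n\<close> of evaluations.
\<close>

lemma bisection_run:
  fixes g :: "real \<Rightarrow> real"
  assumes "g L \<le> b" "b < g U" "0 < \<epsilon>"
  shows "\<exists>l u n. bisection (\<lambda>y. one_fit (g y)) b \<epsilon> L U = Some ((l, u), n) \<and>
    g l \<le> b \<and> b < g u \<and> u - l = (U - L) / 2 ^ n \<and> \<bar>u - l\<bar> \<le> \<epsilon> \<and>
    (n = 0 \<or> 2 ^ (n - 1) * \<epsilon> < \<bar>U - L\<bar>)"
proof -
  define P where "P = (\<lambda>n (l, u). g l \<le> b \<and> b < g u \<and> u - l = (U - L) / 2 ^ n \<and>
    (n = 0 \<or> 2 ^ (n - 1) * \<epsilon> < \<bar>U - L\<bar>))"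
  obtain N where N: "\<bar>U - L\<bar> / \<epsilon> < 2 ^ N"
    using real_arch_pow[of 2] by auto
  have less: "2 ^ n * \<epsilon> < \<bar>U - L\<bar>" if "P n (l, u)" "\<epsilon> < \<bar>l - u\<bar>" for n l u
  proof -
    have "u - l = (U - L) / 2 ^ n" using that(1) by (simp add: P_def)
    then have "\<bar>l - u\<bar> = \<bar>U - L\<bar> / 2 ^ n"
      by (simp add: abs_divide abs_minus_commute[of l u])
    then show ?thesis using that(2) by (simp add: less_divide_eq mult.commute)
  qed
  have "\<exists>s n. run_while (\<lambda>(l, u). \<bar>l - u\<bar> > \<epsilon>)
       (\<lambda>(l, u). bind_run (one_fit (g ((l + u) / 2)))
          (\<lambda>c. return (if c > b then (l, (l + u) / 2) else ((l + u) / 2, u))))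
       (L, U) = Some (s, n) \<and> P n s \<and> \<not> (\<lambda>(l, u). \<bar>l - u\<bar> > \<epsilon>) s"
  proof (rule run_while_induct[where N = N])
    show "P 0 (L, U)" using assms by (simp add: P_def)
  next
    fix n s assume *: "P n s" "case s of (l, u) \<Rightarrow> \<bar>l - u\<bar> > \<epsilon>"
    obtain l u where s: "s = (l, u)" by (cases s)
    have lt: "2 ^ n * \<epsilon> < \<bar>U - L\<bar>" using less * s by simp
    then have "2 ^ n < \<bar>U - L\<bar> / \<epsilon>" using assms(3) by (simp add: field_simps)
    then have "(2::real) ^ n < 2 ^ N" using N by linarith
    then show "n < N" by simp
    show "\<exists>s'. (case s of (l, u) \<Rightarrow> bind_run (one_fit (g ((l + u) / 2)))
          (\<lambda>c. return (if c > b then (l, (l + u) / 2) else ((l + u) / 2, u)))) = Some (s', 1) \<and>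
        P (Suc n) s'"
      using *(1) lt by (auto simp: s return_def P_def field_simps)
  qed
  then obtain l u n where "bisection (\<lambda>y. one_fit (g y)) b \<epsilon> L U = Some ((l, u), n)"
    "P n (l, u)" "\<not> \<bar>l - u\<bar> > \<epsilon>"
    unfolding bisection_def Let_def by fast
  moreover from this have "\<bar>u - l\<bar> \<le> \<epsilon>" by linarith
  ultimately show ?thesis unfolding P_def by blast
qed

text \<open>
  The identity \<open>\<gamma> * \<gamma> = 1 - \<gamma>\<close> is what allows golden section search to reuse one of its two
  interior points after each step.
\<close>

lemma golden_section:
  fixes \<gamma> :: real
  defines "\<gamma> \<equiv> (sqrt 5 - 1) / 2"
  shows "\<gamma> * \<gamma> = 1 - \<gamma>" "1/2 < \<gamma>" "\<gamma> < 1"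
proof -
  have "2 < sqrt (5::real)" "sqrt (5::real) < 3"
    by (auto intro: real_less_rsqrt real_less_lsqrt)
  then show "1/2 < \<gamma>" "\<gamma> < 1" by (auto simp: \<gamma>_def)
  show "\<gamma> * \<gamma> = 1 - \<gamma>" by (simp add: \<gamma>_def field_simps)
qed

text \<open>
  The mode \<open>z\<close> need not lie in \<open>[L\<^sub>0, U\<^sub>0]\<close>. An endpoint that never moved carries no information on
  its side of the mode, whence the two disjunctions.
\<close>

lemma minimizer_run:
  fixes g :: "real \<Rightarrow> real"
  defines "\<gamma> \<equiv> (sqrt 5 - 1) / 2"
  assumes anti: "strict_antimono_on {..z} g" and mono: "strict_mono_on {z..} g"
    and LU: "L\<^sub>0 < U\<^sub>0" and eps: "0 < \<epsilon>"
  shows "\<exists>L U n. minimizer (\<lambda>y. one_fit (g y)) \<epsilon> L\<^sub>0 U\<^sub>0 =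
      Some (if g L < g U then (L, U) else (U, L), 4 + n) \<and>
    L\<^sub>0 \<le> L \<and> L < U \<and> U \<le> U\<^sub>0 \<and> U - L \<le> \<epsilon> \<and>
    (L = L\<^sub>0 \<or> L \<le> z) \<and> (U = U\<^sub>0 \<or> z \<le> U) \<and>
    (n = 0 \<or> \<epsilon> < \<gamma> ^ (n - 1) * (U\<^sub>0 - L\<^sub>0))"
proof -
  note gamma = golden_section[folded \<gamma>_def]
  define P where "P = (\<lambda>n (L, U, s, t, c\<^sub>L, c\<^sub>U, c\<^sub>s, c\<^sub>t).
    L\<^sub>0 \<le> L \<and> U \<le> U\<^sub>0 \<and> U - L = \<gamma> ^ n * (U\<^sub>0 - L\<^sub>0) \<and>
    s = L + (1 - \<gamma>) * (U - L) \<and> t = L + \<gamma> * (U - L) \<and>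
    c\<^sub>L = g L \<and> c\<^sub>U = g U \<and> c\<^sub>s = g s \<and> c\<^sub>t = g t \<and>
    (L = L\<^sub>0 \<or> L \<le> z) \<and> (U = U\<^sub>0 \<or> z \<le> U) \<and>
    (n = 0 \<or> \<epsilon> < \<gamma> ^ (n - 1) * (U\<^sub>0 - L\<^sub>0)))"
  let ?c = "\<lambda>(L :: real, U, _ :: real \<times> real \<times> real \<times> real \<times> real \<times> real). U - L > \<epsilon>"
  let ?body = "\<lambda>(L, U, s, t, c\<^sub>L, c\<^sub>U, c\<^sub>s, c\<^sub>t).
     if c\<^sub>s > c\<^sub>t then
       bind_run (one_fit (g (s + \<gamma> * (U - s)))) (\<lambda>c.
       return (s, U, t, s + \<gamma> * (U - s), c\<^sub>s, c\<^sub>U, c\<^sub>t, c))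
     else
       bind_run (one_fit (g (L + (1 - \<gamma>) * (t - L)))) (\<lambda>c.
       return (L, t, L + (1 - \<gamma>) * (t - L), s, c\<^sub>L, c\<^sub>t, c, c\<^sub>s))"
  let ?s = "L\<^sub>0 + (1 - \<gamma>) * (U\<^sub>0 - L\<^sub>0)" and ?t = "L\<^sub>0 + \<gamma> * (U\<^sub>0 - L\<^sub>0)"
  obtain N where N: "\<gamma> ^ N < \<epsilon> / (U\<^sub>0 - L\<^sub>0)"
    using real_arch_pow_inv[of "\<epsilon> / (U\<^sub>0 - L\<^sub>0)" \<gamma>] gamma LU eps by auto
  have "\<exists>s n. run_while ?c ?body (L\<^sub>0, U\<^sub>0, ?s, ?t, g L\<^sub>0, g U\<^sub>0, g ?s, g ?t) = Some (s, n) \<and>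
      P n s \<and> \<not> ?c s"
  proof (rule run_while_induct[where N = N])
    show "P 0 (L\<^sub>0, U\<^sub>0, ?s, ?t, g L\<^sub>0, g U\<^sub>0, g ?s, g ?t)" by (simp add: P_def)
  next
    fix n st assume *: "P n st" "?c st"
    obtain L U s t c\<^sub>L c\<^sub>U c\<^sub>s c\<^sub>t where st: "st = (L, U, s, t, c\<^sub>L, c\<^sub>U, c\<^sub>s, c\<^sub>t)"
      by (cases st) auto
    have inv: "L\<^sub>0 \<le> L" "U \<le> U\<^sub>0" "U - L = \<gamma> ^ n * (U\<^sub>0 - L\<^sub>0)"
      "s = L + (1 - \<gamma>) * (U - L)" "t = L + \<gamma> * (U - L)"
      "c\<^sub>L = g L" "c\<^sub>U = g U" "c\<^sub>s = g s" "c\<^sub>t = g t"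
      "L = L\<^sub>0 \<or> L \<le> z" "U = U\<^sub>0 \<or> z \<le> U"
      using *(1) by (auto simp: P_def st)
    have D: "\<epsilon> < U - L" using * st by simp
    have lt: "\<epsilon> < \<gamma> ^ n * (U\<^sub>0 - L\<^sub>0)" using D inv(3) by simp
    then have "\<epsilon> / (U\<^sub>0 - L\<^sub>0) < \<gamma> ^ n" using LU by (simp add: field_simps)
    then have "\<gamma> ^ N < \<gamma> ^ n" using N by linarith
    then show "n < N" using gamma by (simp add: power_strict_decreasing_iff)
    have sq: "\<gamma> * (\<gamma> * d) = (1 - \<gamma>) * d" for d
      using gamma(1) by (metis mult.assoc)
    have "0 < (1 - \<gamma>) * (U - L)" "0 < (2 * \<gamma> - 1) * (U - L)"
      using gamma D eps by auto
    then have order: "L < s" "s < t" "t < U"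
      unfolding inv(4,5) by (auto simp: algebra_simps)
    \<comment> \<open>The values at \<open>s\<close> and \<open>t\<close> rule out that the discarded part contains the mode.\<close>
    show "\<exists>s'. ?body st = Some (s', 1) \<and> P (Suc n) s'"
    proof (cases "c\<^sub>s > c\<^sub>t")
      case True
      have "s \<le> z"
      proof (rule ccontr)
        assume "\<not> s \<le> z"
        then have "g s < g t" using mono order by (auto simp: monotone_on_def)
        then show False using True inv by simp
      qed
      moreover have Us: "U - s = \<gamma> * (U - L)" unfolding inv(4) by (simp add: algebra_simps)
      moreover have "t = s + (1 - \<gamma>) * (U - s)"
        unfolding Us using sq[of "U - L"] by (simp add: inv(4,5) algebra_simps)
      ultimately show ?thesis using True inv order lt
        by (auto simp: st P_def return_def)
    next
      case False
      have "z \<le> t"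
      proof (rule ccontr)
        assume "\<not> z \<le> t"
        then have "g t < g s" using anti order by (auto simp: monotone_on_def)
        then show False using False inv by simp
      qed
      moreover have tL: "t - L = \<gamma> * (U - L)" unfolding inv(5) by simp
      moreover have "s = L + \<gamma> * (t - L)"
        unfolding tL sq using inv(4) by simp
      ultimately show ?thesis using False inv order lt
        by (auto simp: st P_def return_def)
    qed
  qed
  then obtain L U s t c\<^sub>L c\<^sub>U c\<^sub>s c\<^sub>t n where run:
    "run_while ?c ?body (L\<^sub>0, U\<^sub>0, ?s, ?t, g L\<^sub>0, g U\<^sub>0, g ?s, g ?t) =
       Some ((L, U, s, t, c\<^sub>L, c\<^sub>U, c\<^sub>s, c\<^sub>t), n)"
    and P: "P n (L, U, s, t, c\<^sub>L, c\<^sub>U, c\<^sub>s, c\<^sub>t)" and "U - L \<le> \<epsilon>"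
    by fastforce
  have "minimizer (\<lambda>y. one_fit (g y)) \<epsilon> L\<^sub>0 U\<^sub>0 =
      Some (if g L < g U then (L, U) else (U, L), 4 + n)"
    using P unfolding minimizer_def Let_def \<gamma>_def[symmetric]
    by (simp add: run return_def) (simp add: P_def)
  moreover have "L < U"
  proof -
    have "0 < U - L" using P gamma LU by (auto simp: P_def)
    then show ?thesis by simp
  qed
  ultimately show ?thesis using P \<open>U - L \<le> \<epsilon>\<close> unfolding P_def prod.case by blast
qed

section \<open>Counting refits\<close>

lemma power_less_imp_less_log:
  fixes a w :: real
  assumes "1 < a" "n = 0 \<or> a ^ (n - 1) < w" "1 \<le> w"
  shows "real n < 1 + log a w"
proof (cases "n = 0")
  case True
  have "0 \<le> log a w" using assms by simp
  then show ?thesis using True by simp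
next
  case False
  then have "a powr real (n - 1) < w"
    using assms powr_realpow[of a "n - 1"] by simp
  then have "real (n - 1) < log a w" using assms by (subst less_log_iff) auto
  then show ?thesis using False by simp
qed

lemma log2_golden_ratio:
  fixes \<phi> :: real
  defines "\<phi> \<equiv> (sqrt 5 + 1) / 2"
  shows "1 < \<phi>" "1 / log 2 \<phi> \<le> 1.45"
proof -
  have s: "2 < sqrt (5::real)" by (auto intro: real_less_rsqrt)
  then show "1 < \<phi>" by (simp add: \<phi>_def)
  \<comment> \<open>Powers of \<open>\<phi>\<close> are \<open>fib k * \<phi> + fib (k - 1)\<close>; repeated squaring reaches \<open>k = 29\<close>.\<close>
  have mult: "(p * \<phi> + q) * (p' * \<phi> + q') =
      (p * p' + p * q' + q * p') * \<phi> + (p * p' + q * q')" for p q p' q'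
  proof -
    have "\<phi> * \<phi> = \<phi> + 1" by (simp add: \<phi>_def field_simps)
    then have "p * p' * (\<phi> * \<phi>) = p * p' * (\<phi> + 1)" by simp
    then show ?thesis by (simp add: algebra_simps)
  qed
  have p1: "\<phi> ^ 1 = 1 * \<phi> + 0" by simp
  have p2: "\<phi> ^ 2 = 1 * \<phi> + 1"
    using mult[of 1 0 1 0] by (simp add: power2_eq_square)
  have p3: "\<phi> ^ 3 = 2 * \<phi> + 1"
    using power_add[of \<phi> 2 1] unfolding p2 p1 mult by simp
  have p6: "\<phi> ^ 6 = 8 * \<phi> + 5"
    using power_add[of \<phi> 3 3] unfolding p3 mult by simp
  have p12: "\<phi> ^ 12 = 144 * \<phi> + 89"
    using power_add[of \<phi> 6 6] unfolding p6 mult by simp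
  have p14: "\<phi> ^ 14 = 377 * \<phi> + 233"
    using power_add[of \<phi> 12 2] unfolding p12 p2 mult by simp
  have p28: "\<phi> ^ 28 = 317811 * \<phi> + 196418"
    using power_add[of \<phi> 14 14] unfolding p14 mult by simp
  have p29: "\<phi> ^ 29 = 514229 * \<phi> + 317811"
    using power_add[of \<phi> 28 1] unfolding p28 p1 mult by simp
  have "\<phi> ^ 29 = 514229 * \<phi> + 317811" by (fact p29)
  also have "\<dots> \<ge> 2 ^ 20" using s by (simp add: \<phi>_def)
  finally have "(2::real) ^ 20 \<le> \<phi> ^ 29" .
  then have "log 2 (2 ^ 20) \<le> log 2 (\<phi> ^ 29)" by (intro log_mono) auto
  also have "\<dots> = 29 * log 2 \<phi>" using \<open>1 < \<phi>\<close> by (simp add: log_nat_power)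
  finally have "log 2 (2 ^ 20) \<le> 29 * log 2 \<phi>" .
  moreover have "log 2 (2 ^ 20) = (20::real)" by (subst log_pow_cancel) auto
  ultimately have "20 / 29 \<le> log 2 \<phi>" by linarith
  then have "1 / log 2 \<phi> \<le> 1 / (20 / 29)" by (intro divide_left_mono) auto
  then show "1 / log 2 \<phi> \<le> 1.45" by simp
qed

lemma bisection_refits:
  assumes "n = 0 \<or> 2 ^ (n - 1) * \<epsilon> < d" "d \<le> w" "0 < \<epsilon>" "\<epsilon> \<le> w"
  shows "real n < 1 + log 2 (w / \<epsilon>)"
  using assms by (intro power_less_imp_less_log) (auto simp: field_simps)

lemma minimizer_refits:
  assumes "n = 0 \<or> \<epsilon> < ((sqrt 5 - 1) / 2) ^ (n - 1) * w" "0 < \<epsilon>" "\<epsilon> \<le> w"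
  shows "real n < 1 + log 2 (w / \<epsilon>) / log 2 ((sqrt 5 + 1) / 2)"
proof -
  let ?\<phi> = "(sqrt 5 + 1) / 2 :: real" and ?\<gamma> = "(sqrt 5 - 1) / 2 :: real"
  have "?\<phi> * ?\<gamma> = 1" by (simp add: field_simps)
  then have eq: "?\<phi> ^ k * ?\<gamma> ^ k = 1" for k
    by (metis power_mult_distrib power_one)
  have "n = 0 \<or> ?\<phi> ^ (n - 1) < w / \<epsilon>"
  proof (cases "n = 0")
    case False
    have "0 < ?\<phi>" using log2_golden_ratio by linarith
    then have "?\<phi> ^ (n - 1) * \<epsilon> < ?\<phi> ^ (n - 1) * (?\<gamma> ^ (n - 1) * w)"
      using False assms(1) by (intro mult_strict_left_mono) auto
    also have "\<dots> = w" using eq[of "n - 1"] by (metis mult.assoc mult_1)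
    finally show ?thesis using assms(2) by (simp add: field_simps)
  qed simp
  then have "real n < 1 + log ?\<phi> (w / \<epsilon>)"
    using assms log2_golden_ratio(1) by (intro power_less_imp_less_log) auto
  also have "log ?\<phi> (w / \<epsilon>) = log 2 (w / \<epsilon>) / log 2 ?\<phi>"
    by (simp add: log_def)
  finally show ?thesis .
qed

lemma emeasure_interval_diff_le:
  fixes S J :: "real set"
  assumes "J \<subseteq> S \<union> {a..b} \<union> {c..d}" "a \<le> b" "c \<le> d" "J - S \<in> sets lebesgue"
  shows "emeasure lebesgue (J - S) \<le> ennreal ((b - a) + (d - c))"
proof -
  have "emeasure lebesgue (J - S) \<le> emeasure lebesgue ({a..b} \<union> {c..d})"
    using assms by (intro emeasure_mono) auto
  also have "\<dots> \<le> emeasure lebesgue {a..b} + emeasure lebesgue {c..d}"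
    by (intro emeasure_subadditive) auto
  also have "\<dots> = ennreal ((b - a) + (d - c))"
    using assms by (simp add: ennreal_plus)
  finally show ?thesis .
qed

section \<open>The shortcut algorithm\<close>

theorem propositionB1:
  fixes A :: "'x::euclidean_space predictor"
    and T :: "(real \<times> 'x) list"
    and x :: 'x
    and \<alpha> \<delta> \<epsilon> :: real
    and K :: int
  assumes "prediction_algorithm A"
    and "T \<noteq> []"
    and "unimodal (\<lambda>y. in_sample_error A (y, x) T)"
    and "\<alpha> \<in> {0<..<1}"
    and "\<epsilon> \<in> {0<..2 powi K}"
  shows "\<exists>PI N.
      shortcut_algorithm A T x \<alpha> \<delta> K \<epsilon> = Some (PI, N) \<and>
      is_interval PI \<and>
      shortcut_set A T x \<alpha> \<delta> \<subseteq> PI \<and>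
      (shortcut_set A T x \<alpha> \<delta> \<noteq> {} \<and>
       shortcut_set A T x \<alpha> \<delta> \<subseteq> {- (2 powi K) + \<epsilon>..2 powi K - \<epsilon>} \<longrightarrow>
         PI - shortcut_set A T x \<alpha> \<delta> \<in> sets lebesgue \<and>
         emeasure lebesgue (PI - shortcut_set A T x \<alpha> \<delta>) \<le> ennreal (2 * \<epsilon>)) \<and>
      (let \<phi> = (sqrt 5 + 1) / 2;
           R = \<lfloor>10 + (real_of_int K + 1 + log 2 (1 / \<epsilon>)) * (2 + 1 / log 2 \<phi>)\<rfloor>
       in int N \<le> R \<and> real_of_int R \<le> 13.45 + 3.45 * log 2 (2 powi K / \<epsilon>))"
proof -
  define g where "g = (\<lambda>y. in_sample_error A (y, x) T)"
  have g: "in_sample_error A (y, x) T = g y" for y by (simp add: g_def)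
  define b where "b = threshold A T \<alpha> \<delta>"
  define B where "B = (2::real) powi K"
  define \<phi> where "\<phi> = (sqrt 5 + 1) / (2::real)"
  define X where "X = log 2 (2 * B / \<epsilon>)"
  define c where "c = 2 + 1 / log 2 \<phi>"
  define S where "S = shortcut_set A T x \<alpha> \<delta>"
  have uni: "unimodal g" using assms(3) by (simp add: g_def)
  then obtain z where anti: "strict_antimono_on {..z} g" and mono: "strict_mono_on {z..} g"
    by (auto simp: unimodal_def)
  have eps: "0 < \<epsilon>" "\<epsilon> \<le> B" using assms(5) by (auto simp: B_def)
  then have B: "0 < B" "- B < B" by auto
  have S: "y \<in> S \<longleftrightarrow> g y \<le> b" for y
    by (simp add: S_def shortcut_set_def g_def b_def)
  have S_interval: "is_interval S"
    using unimodal_sublevel_interval[OF uni, of b] S by (metis Collect_cong Collect_mem_eq)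
  have between: "b < g y \<Longrightarrow> b < g w \<or> b < g v" if "v < y" "y < w" for v y w
    using unimodal_between[OF uni that] by auto

  have X: "X = 1 + log 2 (B / \<epsilon>)" "1 \<le> X"
  proof -
    have "X = log 2 (2 * (B / \<epsilon>))" by (simp add: X_def)
    also have "\<dots> = 1 + log 2 (B / \<epsilon>)" using B eps by (subst log_mult) auto
    finally show "X = 1 + log 2 (B / \<epsilon>)" .
    then show "1 \<le> X" using B eps by simp
  qed
  have c: "2 \<le> c" "c \<le> 3.45" and phi: "0 < 1 / log 2 \<phi>"
    using log2_golden_ratio[folded \<phi>_def] by (auto simp: c_def)
  have Xc: "X * c = 2 * X + X / log 2 \<phi>" by (simp add: c_def algebra_simps)
  have Xphi: "0 \<le> X / log 2 \<phi>" using X phi by simp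

  \<comment> \<open>The strict bound also holds without any iteration, because \<open>1 \<le> X\<close>.\<close>
  have bisect_short: "real n < X" if "n = 0 \<or> 2 ^ (n - 1) * \<epsilon> < d" "d \<le> B" for n d
    using bisection_refits[OF that eps] X(1) by simp
  have bisect_long: "real n < 1 + X" if "n = 0 \<or> 2 ^ (n - 1) * \<epsilon> < d" "d \<le> 2 * B" for n d
    using bisection_refits[OF that eps(1)] eps(2) B by (simp add: X_def)

  have run: "shortcut_algorithm A T x \<alpha> \<delta> K \<epsilon> = map_option (\<lambda>(J, n). (J, 3 + n))
     (if max (g (- B)) (g B) \<le> b then return UNIV
       else if g (- B) \<le> b \<and> b < g B then
         bind_run (bisection (\<lambda>y. one_fit (g y)) b \<epsilon> (- B) B) (\<lambda>(l, u). return {..u})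
       else if g B \<le> b \<and> b < g (- B) then
         bind_run (bisection (\<lambda>y. one_fit (g y)) b \<epsilon> B (- B)) (\<lambda>(l, u). return {u..})
       else bind_run (minimizer (\<lambda>y. one_fit (g y)) \<epsilon> (- B) B) (\<lambda>(m, M).
         if m = - B then return {..<- B + \<epsilon>}
         else if m = B then return {B - \<epsilon><..}
         else bind_run (one_fit (g m)) (\<lambda>c.
           if c > b then return {min m M<..<max m M}
           else bind_run (bisection (\<lambda>y. one_fit (g y)) b \<epsilon> m (- B)) (\<lambda>(l\<^sub>0, l\<^sub>1).
             bind_run (bisection (\<lambda>y. one_fit (g y)) b \<epsilon> m B) (\<lambda>(u\<^sub>0, u\<^sub>1).
             return {l\<^sub>1..u\<^sub>1})))))"
    unfolding shortcut_algorithm_def Let_def g b_def[symmetric] B_def[symmetric]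
    by (simp add: option.map_comp o_def split_def eval_nat_numeral)

  \<comment> \<open>The accuracy claim in geometric form: apart from two pieces of length at most \<open>\<epsilon>\<close>,
    the output lies in \<open>S\<close>.\<close>
  define good where "good = (\<lambda>J n. is_interval J \<and> S \<subseteq> J \<and>
    (S \<noteq> {} \<and> S \<subseteq> {- B + \<epsilon>..B - \<epsilon>} \<longrightarrow>
       (\<exists>p p' q q'. p \<le> p' \<and> p' - p \<le> \<epsilon> \<and> q \<le> q' \<and> q' - q \<le> \<epsilon> \<and> J \<subseteq> S \<union> {p..p'} \<union> {q..q'})) \<and>
    real n \<le> 10 + X * c)"

  have "\<exists>J n. shortcut_algorithm A T x \<alpha> \<delta> K \<epsilon> = Some (J, n) \<and> good J n"
  proof -
    consider (all) "max (g (- B)) (g B) \<le> b" | (left) "g (- B) \<le> b" "b < g B"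
      | (right) "g B \<le> b" "b < g (- B)" | (inner) "b < g (- B)" "b < g B"
      by linarith
    then show ?thesis
    proof cases
      case all
      then have "- B \<in> S" by (simp add: S)
      then have "good UNIV 3" using X Xc Xphi eps by (auto simp: good_def)
      then show ?thesis using run all by (simp add: return_def)
    next
      case left
      obtain l u n where bis: "bisection (\<lambda>y. one_fit (g y)) b \<epsilon> (- B) B = Some ((l, u), n)"
        and lu: "g l \<le> b" "b < g u" "u - l = (B - (- B)) / 2 ^ n"
        and n: "n = 0 \<or> 2 ^ (n - 1) * \<epsilon> < \<bar>B - (- B)\<bar>"
        using bisection_run[of g "- B" b B \<epsilon>] left eps by blast
      have "0 < u - l" unfolding lu(3) using B by simp
      then have "S \<subseteq> {..u}" using between[of l u] lu by (force simp: S not_le[symmetric])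
      moreover have "- B \<in> S" using left by (simp add: S)
      moreover have "real n < 1 + X" using bisect_long[OF n] B by simp
      ultimately have "good {..u} (3 + n)"
        using X Xc Xphi eps by (auto simp: good_def is_interval_1)
      then show ?thesis using run left bis by (simp add: return_def)
    next
      case right
      obtain l u n where bis: "bisection (\<lambda>y. one_fit (g y)) b \<epsilon> B (- B) = Some ((l, u), n)"
        and lu: "g l \<le> b" "b < g u" "u - l = (- B - B) / 2 ^ n"
        and n: "n = 0 \<or> 2 ^ (n - 1) * \<epsilon> < \<bar>- B - B\<bar>"
        using bisection_run[of g B b "- B" \<epsilon>] right eps by blast
      have "u - l < 0" unfolding lu(3) using B by (simp add: divide_less_0_iff)
      then have "S \<subseteq> {u..}" using between[of _ u l] lu by (force simp: S not_le[symmetric])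
      moreover have "B \<in> S" using right by (simp add: S)
      moreover have "real n < 1 + X" using bisect_long[OF n] B by simp
      ultimately have "good {u..} (3 + n)"
        using X Xc Xphi eps by (auto simp: good_def is_interval_1)
      then show ?thesis using run right bis by (simp add: return_def)
    next
      case inner
      obtain L U n where min: "minimizer (\<lambda>y. one_fit (g y)) \<epsilon> (- B) B =
          Some (if g L < g U then (L, U) else (U, L), 4 + n)"
        and LU: "- B \<le> L" "L < U" "U \<le> B" "U - L \<le> \<epsilon>" "L = - B \<or> L \<le> z" "U = B \<or> z \<le> U"
        and n: "n = 0 \<or> \<epsilon> < ((sqrt 5 - 1) / 2) ^ (n - 1) * (B - (- B))"
        using minimizer_run[OF anti mono B(2) eps(1)] by blast
      define m M where "m = (if g L < g U then L else U)" and "M = (if g L < g U then U else L)"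
      have min': "minimizer (\<lambda>y. one_fit (g y)) \<epsilon> (- B) B = Some ((m, M), 4 + n)"
        using min by (simp add: m_def M_def)
      have mB: "- B \<le> m" "m \<le> B" using LU by (auto simp: m_def)
      have nX: "real n < 1 + X / log 2 \<phi>"
        using minimizer_refits[OF n eps(1)] eps B by (simp add: X_def \<phi>_def)
      consider (lower) "m = - B" | (upper) "m \<noteq> - B" "m = B"
        | (none) "m \<noteq> - B" "m \<noteq> B" "b < g m" | (found) "m \<noteq> - B" "m \<noteq> B" "g m \<le> b"
        by linarith
      then show ?thesis
      proof cases
        case lower
        then have L: "L = - B" "g L < g U" using LU by (auto simp: m_def split: if_splits)
        \<comment> \<open>\<open>b < g L < g U\<close>, so a point of \<open>S\<close> at or above \<open>U\<close> would contradict unimodality.\<close>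
        have "S \<subseteq> {..<- B + \<epsilon>}"
        proof
          fix y assume "y \<in> S"
          then have y: "g y \<le> b" by (simp add: S)
          have "\<not> U \<le> y"
            using unimodal_between[OF uni \<open>L < U\<close>, of y] y L inner by (cases "y = U") auto
          then show "y \<in> {..<- B + \<epsilon>}" using LU L by simp
        qed
        moreover from this have "S = {}" if "S \<subseteq> {- B + \<epsilon>..B - \<epsilon>}" using that by force
        ultimately have "good {..<- B + \<epsilon>} (7 + n)"
          using nX X Xc by (auto simp: good_def is_interval_1)
        then show ?thesis using run inner min' lower by (simp add: return_def)
      next
        case upper
        then have U: "U = B" "g U \<le> g L" using LU by (auto simp: m_def split: if_splits)
        have "S \<subseteq> {B - \<epsilon><..}"
        proof
          fix y assume "y \<in> S"
          then have y: "g y \<le> b" by (simp add: S)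
          have "\<not> y \<le> L"
            using unimodal_between[OF uni _ \<open>L < U\<close>, of y] y U inner by (cases "y = L") auto
          then show "y \<in> {B - \<epsilon><..}" using LU U by simp
        qed
        moreover from this have "S = {}" if "S \<subseteq> {- B + \<epsilon>..B - \<epsilon>}" using that by force
        ultimately have "good {B - \<epsilon><..} (7 + n)"
          using nX X Xc by (auto simp: good_def is_interval_1)
        then show ?thesis using run inner min' upper by (simp add: return_def)
      next
        case none
        \<comment> \<open>An endpoint that never moved is the worse one, so the mode cannot lie beyond it:
          \<open>g\<close> would be monotone on \<open>[L, U]\<close> in the wrong direction.\<close>
        have zLU: "L \<le> z" "z \<le> U"
        proof -
          show "L \<le> z"
          proof (rule ccontr)
            assume z: "\<not> L \<le> z"
            then have "g L < g U" using mono \<open>L < U\<close> by (simp add: monotone_on_def)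
            then have "m = - B" using z LU(5) by (simp add: m_def)
            then show False using none(1) by simp
          qed
          show "z \<le> U"
          proof (rule ccontr)
            assume z: "\<not> z \<le> U"
            then have "g U < g L" using anti \<open>L < U\<close> by (simp add: monotone_on_def)
            then have "m = B" using z LU(6) by (simp add: m_def)
            then show False using none(2) by simp
          qed
        qed
        have gLU: "b < g L" "b < g U" using none by (auto simp: m_def split: if_splits)
        have "S \<subseteq> {L<..<U}"
        proof
          fix y assume "y \<in> S"
          then have y: "g y \<le> b" by (simp add: S)
          have "y \<le> L \<Longrightarrow> g L \<le> g y"
            using anti zLU by (cases "y = L") (auto simp: monotone_on_def less_imp_le)
          moreover have "U \<le> y \<Longrightarrow> g U \<le> g y"
            using mono zLU by (cases "y = U") (auto simp: monotone_on_def less_imp_le)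
          ultimately show "y \<in> {L<..<U}" using y gLU by force
        qed
        moreover have "\<exists>p p' q q'. p \<le> p' \<and> p' - p \<le> \<epsilon> \<and> q \<le> q' \<and> q' - q \<le> \<epsilon> \<and>
            {L<..<U} \<subseteq> S \<union> {p..p'} \<union> {q..q'}"
          using LU by (intro exI[of _ L] exI[of _ U]) auto
        ultimately have "good {L<..<U} (8 + n)"
          using nX X Xc by (auto simp: good_def is_interval_1)
        moreover have "min m M = L" "max m M = U" using LU by (auto simp: m_def M_def)
        ultimately show ?thesis using run inner min' none by (simp add: return_def)
      next
        case found
        obtain l\<^sub>0 l\<^sub>1 n\<^sub>1 where
          bis1: "bisection (\<lambda>y. one_fit (g y)) b \<epsilon> m (- B) = Some ((l\<^sub>0, l\<^sub>1), n\<^sub>1)"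
          and l: "g l\<^sub>0 \<le> b" "b < g l\<^sub>1" "l\<^sub>1 - l\<^sub>0 = (- B - m) / 2 ^ n\<^sub>1" "\<bar>l\<^sub>1 - l\<^sub>0\<bar> \<le> \<epsilon>"
          and n1: "n\<^sub>1 = 0 \<or> 2 ^ (n\<^sub>1 - 1) * \<epsilon> < \<bar>- B - m\<bar>"
          using bisection_run[of g m b "- B" \<epsilon>] found inner eps by blast
        obtain u\<^sub>0 u\<^sub>1 n\<^sub>2 where
          bis2: "bisection (\<lambda>y. one_fit (g y)) b \<epsilon> m B = Some ((u\<^sub>0, u\<^sub>1), n\<^sub>2)"
          and u: "g u\<^sub>0 \<le> b" "b < g u\<^sub>1" "u\<^sub>1 - u\<^sub>0 = (B - m) / 2 ^ n\<^sub>2" "\<bar>u\<^sub>1 - u\<^sub>0\<bar> \<le> \<epsilon>"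
          and n2: "n\<^sub>2 = 0 \<or> 2 ^ (n\<^sub>2 - 1) * \<epsilon> < \<bar>B - m\<bar>"
          using bisection_run[of g m b B \<epsilon>] found inner eps by blast
        have "l\<^sub>1 - l\<^sub>0 < 0" unfolding l(3) using found mB by (simp add: divide_less_0_iff)
        moreover have "0 < u\<^sub>1 - u\<^sub>0" unfolding u(3) using found mB by simp
        ultimately have lu: "l\<^sub>1 < l\<^sub>0" "u\<^sub>0 < u\<^sub>1" by auto
        have "S \<subseteq> {l\<^sub>1..u\<^sub>1}"
          using between[of _ l\<^sub>1 l\<^sub>0] between[of u\<^sub>0 u\<^sub>1] l u lu by (force simp: S not_le[symmetric])
        moreover have "{l\<^sub>1..u\<^sub>1} \<subseteq> S \<union> {l\<^sub>1..l\<^sub>0} \<union> {u\<^sub>0..u\<^sub>1}"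
        proof
          fix y assume y: "y \<in> {l\<^sub>1..u\<^sub>1}"
          have "y \<in> S" if "l\<^sub>0 \<le> y" "y \<le> u\<^sub>0"
            using S_interval that l u by (meson S is_interval_1)
          then show "y \<in> S \<union> {l\<^sub>1..l\<^sub>0} \<union> {u\<^sub>0..u\<^sub>1}" using y by force
        qed
        then have "\<exists>p p' q q'. p \<le> p' \<and> p' - p \<le> \<epsilon> \<and> q \<le> q' \<and> q' - q \<le> \<epsilon> \<and>
            {l\<^sub>1..u\<^sub>1} \<subseteq> S \<union> {p..p'} \<union> {q..q'}"
          using lu l(4) u(4) by (intro exI[of _ l\<^sub>1] exI[of _ l\<^sub>0] exI[of _ u\<^sub>0] exI[of _ u\<^sub>1]) auto
        moreover have "real n\<^sub>1 + real n\<^sub>2 < 1 + 2 * X"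
          \<comment> \<open>The bracket on the side of the nearer boundary point has width at most \<open>B\<close>.\<close>
        proof (cases "m \<le> 0")
          case True
          then show ?thesis using bisect_short[OF n1] bisect_long[OF n2] mB by simp
        next
          case False
          then show ?thesis using bisect_long[OF n1] bisect_short[OF n2] mB by simp
        qed
        ultimately have "good {l\<^sub>1..u\<^sub>1} (8 + n + n\<^sub>1 + n\<^sub>2)"
          using nX X Xc by (auto simp: good_def is_interval_1)
        then show ?thesis using run inner min' found bis1 bis2 by (simp add: return_def add_ac)
      qed
    qed
  qed
  then obtain J n where alg: "shortcut_algorithm A T x \<alpha> \<delta> K \<epsilon> = Some (J, n)" and good: "good J n"
    by blast
  have meas: "J - S \<in> sets lebesgue"
    using good S_interval real_interval_borel_measurable
    by (intro sets.Diff sets_completionI_sets) (auto simp: good_def)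
  have "emeasure lebesgue (J - S) \<le> ennreal (2 * \<epsilon>)"
    if window: "S \<noteq> {}" "S \<subseteq> {- B + \<epsilon>..B - \<epsilon>}"
  proof -
    obtain p p' q q' where pq: "p \<le> p'" "p' - p \<le> \<epsilon>" "q \<le> q'" "q' - q \<le> \<epsilon>"
      "J \<subseteq> S \<union> {p..p'} \<union> {q..q'}"
      using good window unfolding good_def by blast
    have "emeasure lebesgue (J - S) \<le> ennreal ((p' - p) + (q' - q))"
      using emeasure_interval_diff_le pq meas by blast
    also have "\<dots> \<le> ennreal (2 * \<epsilon>)" using pq by (intro ennreal_leI) simp
    finally show ?thesis .
  qed
  moreover have "real_of_int K + 1 + log 2 (1 / \<epsilon>) = X"
  proof -
    have "log 2 B = real_of_int K"
      by (simp add: B_def powr_real_of_int'[symmetric])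
    then show ?thesis using eps B by (simp add: X log_divide)
  qed
  moreover have "int n \<le> \<lfloor>10 + X * c\<rfloor>"
  proof -
    have "real n \<le> 10 + X * c" using good unfolding good_def by blast
    then show ?thesis by (subst le_floor_iff) simp
  qed
  moreover have "real_of_int \<lfloor>10 + X * c\<rfloor> \<le> 13.45 + 3.45 * log 2 (B / \<epsilon>)"
  proof -
    have "real_of_int \<lfloor>10 + X * c\<rfloor> \<le> 10 + X * c" by simp
    also have "\<dots> \<le> 10 + X * 3.45" using c X(2) by (intro add_left_mono mult_left_mono) auto
    also have "\<dots> = 13.45 + 3.45 * log 2 (B / \<epsilon>)" unfolding X(1) by (simp add: field_simps)
    finally show ?thesis .
  qed
  ultimately show ?thesis
    using alg good meas
    unfolding Let_def S_def[symmetric] B_def[symmetric] \<phi>_def[symmetric] c_def[symmetric]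
    by (intro exI[of _ J] exI[of _ n]) (simp add: good_def)
qed

end
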